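(* Let $0 < \theta \leq 1$, let $m$ be a positive integer or $m = \infty$, and let $k$ be a (finite) positive integer with $k \leq m$. Then $\text{NegOcc}(m, 1, \theta) = \text{Geom}(\theta)$, and for $k \geq 2$ the negative occupancy distribution satisfies the recursive convolution equation $$\text{NegOcc}(m, k, \theta) = \text{NegOcc}(m, k-1, \theta) * \text{Geom}\left(\theta \cdot \frac{m-k+1}{m}\right).$$ Consequently, for every $k \geq 1$, $$\text{NegOcc}(m, k, \theta) = \text{Geom}(\theta) * \text{Geom}\left(\theta \cdot \frac{m-1}{m}\right) * \cdots * \text{Geom}\left(\theta \cdot \frac{m-k+1}{m}\right).$$
   Context: Falling factorials: $(m)_k = \prod_{i=0}^{k-1}(m-i)$. The noncentral Stirling numbers of the second kind are, for integers $n, k \geq 0$ and real $\phi$, $$S(n,k,\phi) = \frac{1}{k!}\sum_{i=0}^{k} \binom{k}{i} (-1)^{k-i} (i+\phi)^n, \qquad 0^0 = 1.$$ For finite $m$, $0 < k \leq m$ and $0 < \theta \leq 1$, the negative occupancy distribution $\text{NegOcc}(m,k,\theta)$ is the distribution on the integers $t \geq 0$ with probability mass function $$\text{NegOcc}(t|m,k,\theta) = \frac{\theta^{k+t}}{m^{k+t}} \cdot (m)_k \cdot S\left(k+t-1, k-1, m\cdot\frac{1-\theta}{\theta}\right).$$ For $m = \infty$ the mass function is understood as the limit as $m \to \infty$, namely the negative binomial mass function $\text{NegOcc}(t|\infty,k,\theta) = \binom{t+k-1}{t}\theta^k(1-\theta)^t$, and each ratio $(m-j)/m$ is read as $1$.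 $\text{Geom}(p)$ denotes the geometric distribution on $s = 0,1,2,\ldots$ with mass function $\text{Geom}(s|p) = (1-p)^s p$ (with $0^0=1$). The symbol $*$ denotes convolution of distributions on the non-negative integers: $(f*g)(t) = \sum_{s=0}^{t} f(s) g(t-s)$. *)

theory Defs
  imports "HOL-Probability.Probability_Mass_Function" "HOL-Library.Extended_Nat"
begin

definition falling_factorial :: "real \<Rightarrow> nat \<Rightarrow> real" where
  "falling_factorial x k = (\<Prod>i<k. x - real i)"

definition noncentral_Stirling :: "nat \<Rightarrow> nat \<Rightarrow> real \<Rightarrow> real" where
  "noncentral_Stirling n k \<phi> =
     1 / fact k * (\<Sum>i=0..k. real (k choose i) * (-1) ^ (k - i) * (real i + \<phi>) ^ n)"

text \<open>Mass functions on the non-negative integers are represented as functions of type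
  \<^typ>\<open>nat \<Rightarrow> real\<close>. The mass function \<open>neg_occ m k \<theta>\<close> is meaningful only for
  \<open>0 < k \<le> m\<close> and \<open>0 < \<theta> \<le> 1\<close>; for \<open>k = 0\<close> the subtractions on \<^typ>\<open>nat\<close> truncate.
  For \<open>m = \<infinity>\<close> it is the negative binomial mass function, the limit of the finite case.\<close>

definition neg_occ :: "enat \<Rightarrow> nat \<Rightarrow> real \<Rightarrow> nat \<Rightarrow> real" where
  "neg_occ m k \<theta> t =
     (case m of
        enat M \<Rightarrow> \<theta> ^ (k + t) / real M ^ (k + t) * falling_factorial (real M) k
                  * noncentral_Stirling (k + t - 1) (k - 1) (real M * ((1 - \<theta>) / \<theta>))
      | \<infinity> \<Rightarrow> real ((t + k - 1) choose t) * \<theta> ^ k * (1 - \<theta>) ^ t)"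

text \<open>The ratio \<open>(m - j) / m\<close>, read as \<open>1\<close> for \<open>m = \<infinity>\<close>.\<close>

definition vacancy_ratio :: "enat \<Rightarrow> nat \<Rightarrow> real" where
  "vacancy_ratio m j = (case m of enat M \<Rightarrow> (real M - real j) / real M | \<infinity> \<Rightarrow> 1)"

text \<open>By \<open>pmf_geometric\<close>, for \<open>0 < p \<le> 1\<close> this is \<open>\<lambda>s. (1 - p) ^ s * p\<close>.\<close>

abbreviation geom :: "real \<Rightarrow> nat \<Rightarrow> real" where
  "geom p \<equiv> pmf (geometric_pmf p)"

definition convolve :: "(nat \<Rightarrow> real) \<Rightarrow> (nat \<Rightarrow> real) \<Rightarrow> nat \<Rightarrow> real" where
  "convolve f g t = (\<Sum>s=0..t. f s * g (t - s))"

end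

(* A convolution h = f * Geom(p) is characterised by the first-order recurrence
   h(0) = p f(0), h(t+1) = (1 - p) h(t) + p f(t+1). For h = NegOcc(m, k + 1), f = NegOcc(m, k) and
   p = theta (m - k) / m, one has 1 - p = (theta / m) (k + phi) with phi = m (1 - theta) / theta, so
   this recurrence is the triangular recurrence
   S(n+1, k, phi) = S(n, k-1, phi) + (k + phi) S(n, k, phi) of the noncentral Stirling numbers.
   For infinite m it is Pascal's rule. *)
theory Submission
  imports Defs
begin

lemma noncentral_Stirling_0_right: "noncentral_Stirling n 0 \<phi> = \<phi> ^ n"
  by (simp add: noncentral_Stirling_def)

text \<open>Every power is 1 here, so the alternating sum is the binomial expansion of (1 - 1)^(k +
  1).\<close>

lemma noncentral_Stirling_0_Suc: "noncentral_Stirling 0 (Suc k) \<phi> = 0"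
proof -
  have "(\<Sum>i\<le>Suc k. real (Suc k choose i) * 1 ^ i * (-1) ^ (Suc k - i)) = (1 + (-1)) ^ Suc k"
    by (rule binomial_ring[symmetric])
  then show ?thesis
    by (simp add: noncentral_Stirling_def atMost_atLeast0 del: sum.atMost_Suc sum.atLeast0_atMost_Suc)
qed

text \<open>Split the extra factor i + \<phi> as (k + 1 + \<phi>) - (k + 1 - i). The first part
  keeps the lower index; in the second, (k + 1 - i) * (k + 1 choose i) = (k + 1) * (k choose i)
  lowers it, and the lost factor -1 turns the difference into a sum.\<close>

lemma noncentral_Stirling_Suc_Suc:
  "noncentral_Stirling (Suc n) (Suc k) \<phi> =
     noncentral_Stirling n k \<phi> + (real (Suc k) + \<phi>) * noncentral_Stirling n (Suc k) \<phi>"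
proof -
  let ?b = "\<lambda>i. real (Suc k choose i) * (-1) ^ (Suc k - i) * (real i + \<phi>) ^ n"
  let ?c = "\<lambda>i. real (k choose i) * (-1) ^ (k - i) * (real i + \<phi>) ^ n"
  have absorb: "(real (Suc k) - real i) * ?b i = - (real (Suc k) * ?c i)" if "i \<le> k" for i
  proof -
    have "(Suc k - i) * (Suc k choose i) = Suc k * (k choose i)"
      using binomial_absorb_comp[of "Suc k" i] by simp
    then have "real (Suc k - i) * real (Suc k choose i) = real (Suc k) * real (k choose i)"
      by (metis of_nat_mult)
    then have comp: "(real (Suc k) - real i) * real (Suc k choose i) = real (Suc k) * real (k choose i)"
      using that by (simp add: of_nat_diff)
    have "(real (Suc k) - real i) * ?b i
        = ((real (Suc k) - real i) * real (Suc k choose i)) * ((-1) ^ (Suc k - i) * (real i + \<phi>) ^ n)"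
      by (simp only: mult.assoc)
    also have "\<dots> = - (real (Suc k) * ?c i)"
      unfolding comp using that by (simp add: Suc_diff_le)
    finally show ?thesis .
  qed
  have "(\<Sum>i=0..Suc k. real (Suc k choose i) * (-1) ^ (Suc k - i) * (real i + \<phi>) ^ Suc n)
      = (\<Sum>i=0..Suc k. (real (Suc k) + \<phi>) * ?b i - (real (Suc k) - real i) * ?b i)"
    by (rule sum.cong) (simp_all add: algebra_simps)
  also have "\<dots> = (real (Suc k) + \<phi>) * (\<Sum>i=0..Suc k. ?b i)
      - (\<Sum>i=0..Suc k. (real (Suc k) - real i) * ?b i)"
    by (simp only: sum_subtractf sum_distrib_left)
  \<comment> \<open>The term i = k + 1 has factor 0, which leaves exactly the range where
    \<open>absorb\<close> applies.\<close>
  also have "(\<Sum>i=0..Suc k. (real (Suc k) - real i) * ?b i)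
      = (\<Sum>i=0..k. (real (Suc k) - real i) * ?b i)"
    by simp
  also have "\<dots> = - (real (Suc k) * (\<Sum>i=0..k. ?c i))"
    unfolding sum_distrib_left sum_negf[symmetric] by (rule sum.cong) (simp_all only: absorb atLeastAtMost_iff)
  finally have "(\<Sum>i=0..Suc k. real (Suc k choose i) * (-1) ^ (Suc k - i) * (real i + \<phi>) ^ Suc n)
      = (real (Suc k) + \<phi>) * (\<Sum>i=0..Suc k. ?b i) + real (Suc k) * (\<Sum>i=0..k. ?c i)"
    by simp
  \<comment> \<open>The factor k + 1 from the absorption turns 1/(k + 1)! into 1/k!.\<close>
  moreover have "1 / fact (Suc k) * (a * x + real (Suc k) * y) = 1 / fact k * y + a * (1 / fact (Suc k) * x)"
    for a x y :: real
    unfolding fact_Suc by (simp add: add_divide_distrib del: of_nat_Suc)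
  ultimately show ?thesis
    unfolding noncentral_Stirling_def by (simp only:)
qed

text \<open>Both terms of the triangular recurrence stay above the diagonal. On the diagonal this
  leaves only the term S(n, k, \<phi>), hence the constant value 1 in the next lemma.\<close>

lemma noncentral_Stirling_eq_0: "n < k \<Longrightarrow> noncentral_Stirling n k \<phi> = 0"
proof (induction n arbitrary: k)
  case 0
  then show ?case by (cases k) (simp_all add: noncentral_Stirling_0_Suc)
next
  case (Suc n)
  then obtain j where "k = Suc j" "n < j" by (cases k) auto
  with Suc.IH show ?case by (simp add: noncentral_Stirling_Suc_Suc)
qed

lemma noncentral_Stirling_self: "noncentral_Stirling k k \<phi> = 1"
  by (induction k)
    (simp_all add: noncentral_Stirling_0_right noncentral_Stirling_Suc_Suc noncentral_Stirling_eq_0)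

lemma eq_convolve_geomI:
  assumes "0 < p" "p \<le> 1"
    and "h 0 = p * f 0"
    and "\<And>t. h (Suc t) = (1 - p) * h t + p * f (Suc t)"
  shows "h = convolve f (geom p)"
proof
  fix t
  show "h t = convolve f (geom p) t"
  proof (induction t)
    case 0
    then show ?case using assms by (simp add: convolve_def)
  next
    case (Suc t)
    \<comment> \<open>Each old term picks up one more factor 1 - p; the new term s = t + 1 has
      weight \<open>geom p 0\<close>, which is p.\<close>
    have "(\<Sum>s=0..t. f s * geom p (Suc t - s)) = (1 - p) * (\<Sum>s=0..t. f s * geom p (t - s))"
      unfolding sum_distrib_left using assms(1,2) by (intro sum.cong) (auto simp: Suc_diff_le)
    then show ?case
      using Suc assms by (simp add: convolve_def)
  qed
qed

text \<open>For finite m the Stirling factor is \<phi>^t with \<phi> = m (1 - \<theta>) / \<theta>,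
  so all powers of m cancel.\<close>

lemma neg_occ_1:
  assumes "0 < \<theta>" "\<theta> \<le> 1" "0 < m"
  shows "neg_occ m 1 \<theta> = geom \<theta>"
proof
  fix t
  show "neg_occ m 1 \<theta> t = geom \<theta> t"
  proof (cases m)
    case (enat M)
    then have "0 < M" using assms(3) by (simp add: zero_enat_def)
    then show ?thesis using assms(1,2) enat
      by (simp add: neg_occ_def falling_factorial_def noncentral_Stirling_0_right
          power_mult_distrib power_divide)
  next
    case infinity
    then show ?thesis using assms(1,2) by (simp add: neg_occ_def)
  qed
qed

lemma vacancy_ratio_bounds:
  assumes "enat (Suc k) \<le> m"
  shows "0 < vacancy_ratio m k" "vacancy_ratio m k \<le> 1"
  using assms by (cases m; simp add: vacancy_ratio_def)+

lemma neg_occ_Suc: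
  assumes \<theta>: "0 < \<theta>" "\<theta> \<le> 1" and k: "0 < k" "enat (Suc k) \<le> m"
  shows "neg_occ m (Suc k) \<theta> = convolve (neg_occ m k \<theta>) (geom (\<theta> * vacancy_ratio m k))"
proof (rule eq_convolve_geomI)
  let ?p = "\<theta> * vacancy_ratio m k"
  show "0 < ?p" using \<theta> vacancy_ratio_bounds[OF k(2)] by simp
  show "?p \<le> 1" using \<theta> vacancy_ratio_bounds[OF k(2)] by (simp add: mult_le_one)
  \<comment> \<open>With k = j + 1 the truncated subtractions in \<open>neg_occ\<close>
    disappear.\<close>
  obtain j where j: "k = Suc j" using k(1) by (cases k) auto
  have "neg_occ m (Suc k) \<theta> 0 = ?p * neg_occ m k \<theta> 0
    \<and> (\<forall>t. neg_occ m (Suc k) \<theta> (Suc t) = (1 - ?p) * neg_occ m (Suc k) \<theta> t + ?p * neg_occ m k \<theta> (Suc t))"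
  proof (cases m)
    case (enat M)
    define x where "x = \<theta> / real M"
    define \<phi> where "\<phi> = real M * ((1 - \<theta>) / \<theta>)"
    have "0 < M" using k(2) enat by simp
    \<comment> \<open>Here x * \<phi> = 1 - \<theta> and \<open>?p\<close> is \<theta> - x *
      k.\<close>
    then have one_minus_p: "1 - ?p = x * (real k + \<phi>)"
      using \<theta> enat by (simp add: x_def \<phi>_def vacancy_ratio_def field_simps)
    have p: "?p = x * (real M - real k)"
      using enat by (simp add: x_def vacancy_ratio_def)
    have occ: "neg_occ m i \<theta> t =
        x ^ (i + t) * falling_factorial (real M) i * noncentral_Stirling (i + t - 1) (i - 1) \<phi>" for i t
      using enat by (simp add: neg_occ_def x_def \<phi>_def power_divide)
    have ff: "falling_factorial (real M) (Suc k) = falling_factorial (real M) k * (real M - real k)"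
      by (simp add: falling_factorial_def)
    \<comment> \<open>At t = 0 both Stirling numbers lie on the diagonal and equal 1.\<close>
    have "neg_occ m (Suc k) \<theta> 0 = ?p * neg_occ m k \<theta> 0"
      unfolding p occ ff by (simp add: j noncentral_Stirling_self)
    moreover have "neg_occ m (Suc k) \<theta> (Suc t)
        = (1 - ?p) * neg_occ m (Suc k) \<theta> t + ?p * neg_occ m k \<theta> (Suc t)" for t
      \<comment> \<open>Rewriting 1 - \<open>?p\<close> before \<open>?p\<close> itself brings out
        the coefficient k + \<phi> of the triangular recurrence.\<close>
      unfolding one_minus_p unfolding p occ ff
      by (simp add: j noncentral_Stirling_Suc_Suc[of _ j] algebra_simps)
    ultimately show ?thesis by blast
  next
    case infinity
    then show ?thesis
      by (simp add: neg_occ_def vacancy_ratio_def j algebra_simps)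
  qed
  then show "neg_occ m (Suc k) \<theta> 0 = ?p * neg_occ m k \<theta> 0"
    and "\<And>t. neg_occ m (Suc k) \<theta> (Suc t)
      = (1 - ?p) * neg_occ m (Suc k) \<theta> t + ?p * neg_occ m k \<theta> (Suc t)"
    by blast+
qed

text \<open>The list starts at 1 because the factor for j = 0 is the seed
  \<open>geom \<theta>\<close>. Passing from k to k + 1 appends j = k on the right, which is one
  more outer convolution of the left fold.\<close>

lemma neg_occ_eq_foldl_convolve:
  assumes "0 < \<theta>" "\<theta> \<le> 1" "0 < k" "enat k \<le> m"
  shows "neg_occ m k \<theta> = foldl convolve (geom \<theta>) (map (\<lambda>j. geom (\<theta> * vacancy_ratio m j)) [1..<k])"
  using assms(3,4)
proof (induction k rule: nat_induct_non_zero)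
  case 1
  then have "0 < m" by (metis enat_0_iff(1) i0_lb order_less_le zero_neq_one le_zero_eq)
  then show ?case using neg_occ_1[OF assms(1,2)] by simp
next
  case (Suc k)
  have "enat k \<le> m"
    using Suc.prems by (meson enat_ord_simps(1) le_SucI order_refl order_trans)
  with Suc show ?case
    using neg_occ_Suc[OF assms(1,2)] by simp
qed

theorem theorem1:
  fixes \<theta> :: real and m :: enat and k :: nat
  assumes "0 < \<theta>" and "\<theta> \<le> 1"
    and "0 < m"
    and "0 < k" and "enat k \<le> m"
  shows "neg_occ m 1 \<theta> = geom \<theta>
    \<and> (2 \<le> k \<longrightarrow>
         neg_occ m k \<theta> = convolve (neg_occ m (k - 1) \<theta>) (geom (\<theta> * vacancy_ratio m (k - 1))))
    \<and> neg_occ m k \<theta> = foldl convolve (geom \<theta>) (map (\<lambda>j. geom (\<theta> * vacancy_ratio m j)) [1..<k])"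
  using assms neg_occ_1 neg_occ_eq_foldl_convolve neg_occ_Suc[of \<theta> "k - 1" m] by simp

end
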